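(* Let $n\ge 3$ and let $W_n$ denote the wheel graph on $n+1$ vertices (a cycle on $n$ vertices together with one additional center vertex adjacent to every vertex of the cycle). Then $$Z^+_{(\ell)}(W_n) = \begin{cases} 3 & \text{if } \ell\in\{0,1\},\\ \lceil n/2\rceil + 1 & \text{if } \ell = 2,\\ n & \text{if } 2<\ell<n,\\ n+1 & \text{if } \ell\in\{n,n+1\}.\end{cases}$$
   Context: All graphs are finite, simple and undirected. Positive semidefinite (psd) color change rule: given the current set $B$ of blue vertices of a graph $G$, let $W_1,\dots,W_k$ be the vertex sets of the connected components of $G-B$. If $u\in B$ and $w\in W_i$ is the only non-blue neighbor of $u$ in the induced subgraph $G[W_i\cup B]$, then $u$ may force $w$ (written $u\to w$), and $w$ becomes blue. The rule is applied iteratively, with the components recomputed from the current blue set. A leak is a vertex that is not allowed to perform any force. For $0\le \ell\le |V(G)|$, a set $B\subseteq V(G)$ is an $\ell$-leaky positive semidefinite forcing set of $G$ if, for every choice of $\ell$ vertices as leaks (chosen after $B$ is fixed; leaks may be inside or outside $B$), starting with exactly $B$ blue, iterated application of the psd color change rule, with forces performed only by non-leak vertices, colors all of $V(G)$ blue. The $\ell$-leaky positive semidefinite forcing number $Z^+_{(\ell)}(G)$ is the minimum cardinality of an $\ell$-leaky positive semidefinite forcing set of $G$. *)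

theory Defs
  imports Complex_Main
begin

text \<open>
  A finite simple undirected graph is given by its vertex set and its set of
  two-element edges. The definitions below are only meaningful for graphs
  satisfying \<open>simple_graph\<close>.
\<close>

record 'a ugraph =
  verts :: "'a set"
  edges :: "'a set set"

definition simple_graph :: "'a ugraph \<Rightarrow> bool" where
  "simple_graph G \<longleftrightarrow>
     finite (verts G) \<and>
     (\<forall>e\<in>edges G. \<exists>u\<in>verts G. \<exists>v\<in>verts G. u \<noteq> v \<and> e = {u, v})"

definition neighbors :: "'a ugraph \<Rightarrow> 'a \<Rightarrow> 'a set" where
  "neighbors G u = {v. {u, v} \<in> edges G}"

definition induced :: "'a ugraph \<Rightarrow> 'a set \<Rightarrow> 'a ugraph" where
  "induced G S = \<lparr>verts = verts G \<inter> S, edges = {e \<in> edges G. e \<subseteq> S}\<rparr>"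

definition component_sets :: "'a ugraph \<Rightarrow> 'a set set" where
  "component_sets G =
     verts G // {(u, v) \<in> verts G \<times> verts G. (u, v) \<in> {(x, y). {x, y} \<in> edges G}\<^sup>*}"

definition psd_force :: "'a ugraph \<Rightarrow> 'a set \<Rightarrow> 'a \<Rightarrow> 'a \<Rightarrow> bool" where
  "psd_force G B u w \<longleftrightarrow>
     u \<in> B \<and>
     (\<exists>W \<in> component_sets (induced G (verts G - B)).
        w \<in> W \<and> neighbors (induced G (W \<union> B)) u - B = {w})"

text \<open>
  \<open>psd_reachable G L B C\<close>: the blue set \<open>C\<close> can be obtained from the initial blue
  set \<open>B\<close> by successive psd forces, none of them performed by a vertex in \<open>L\<close>; the
  components are those left by the current blue set.
\<close>

inductive psd_reachable :: "'a ugraph \<Rightarrow> 'a set \<Rightarrow> 'a set \<Rightarrow> 'a set \<Rightarrow> bool"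
  for G :: "'a ugraph" and L :: "'a set" and B :: "'a set" where
  start: "psd_reachable G L B B"
| force: "\<lbrakk>psd_reachable G L B C; psd_force G C u w; u \<notin> L\<rbrakk> \<Longrightarrow> psd_reachable G L B (insert w C)"

text \<open>
  For \<open>l > card (verts G)\<close> there is no choice of \<open>l\<close> leaks and every set of vertices
  qualifies vacuously; the notion is intended for \<open>l \<le> card (verts G)\<close> only.
\<close>

definition leaky_psd_forcing_set :: "nat \<Rightarrow> 'a ugraph \<Rightarrow> 'a set \<Rightarrow> bool" where
  "leaky_psd_forcing_set l G B \<longleftrightarrow>
     B \<subseteq> verts G \<and>
     (\<forall>L. L \<subseteq> verts G \<and> card L = l \<longrightarrow> psd_reachable G L B (verts G))"

text \<open>
  For a finite graph the minimum ranges over a finite set, which contains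
  \<open>card (verts G)\<close>.
\<close>

definition leaky_psd_forcing_number :: "nat \<Rightarrow> 'a ugraph \<Rightarrow> nat" where
  "leaky_psd_forcing_number l G = Min {card B |B. leaky_psd_forcing_set l G B}"

text \<open>The rim is the cycle on \<open>0, \<dots>, n - 1\<close>; the center is the vertex \<open>n\<close>.\<close>

definition wheel :: "nat \<Rightarrow> nat ugraph" where
  "wheel n = \<lparr>verts = {0..n},
     edges = {{i, (i + 1) mod n} |i. i < n} \<union> {{i, n} |i. i < n}\<rparr>"

lemma simple_graph_wheel:
  assumes "n \<ge> 3"
  shows "simple_graph (wheel n)"
  unfolding simple_graph_def
proof (intro conjI ballI)
  show "finite (verts (wheel n))"
    by (simp add: wheel_def)
next
  fix e
  assume "e \<in> edges (wheel n)"
  then obtain i where i: "i < n" and e: "e = {i, (i + 1) mod n} \<or> e = {i, n}"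
    by (auto simp: wheel_def)
  have "i \<noteq> (i + 1) mod n"
    using assms i by (cases "i + 1 = n") auto
  moreover have "(i + 1) mod n \<le> n"
    using assms by (simp add: less_imp_le)
  ultimately obtain v where "v \<le> n" "i \<noteq> v" "e = {i, v}"
    using e i by blast
  with i show "\<exists>u\<in>verts (wheel n). \<exists>v\<in>verts (wheel n). u \<noteq> v \<and> e = {u, v}"
    by (intro bexI[of _ i] bexI[of _ v]) (simp_all add: wheel_def)
qed

lemma card_verts_wheel: "card (verts (wheel n)) = n + 1"
  by (simp add: wheel_def)

end

theory Submission
  imports Defs
begin

text \<open>
  Upper bounds: if the white vertices are pairwise non-adjacent, each of them is a component of
  its own, so any non-leak neighbor forces it; hence it suffices that white vertices have more
  than \<open>l\<close> neighbors. This settles the cases \<open>l \<ge> 2\<close> with the center and every other rim vertex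
  blue, the whole rim blue, and everything blue. For \<open>l \<le> 1\<close> the center and two consecutive rim
  vertices suffice, because the white arc can be eaten up from both ends.

  Lower bounds: a vertex with at most \<open>l\<close> neighbors must be blue. Two adjacent white rim
  vertices stay white when the two ends of their white arc are leaks, since the center always
  sees two adjacent white vertices in that arc. Finally, at most two blue vertices never
  disconnect the wheel, and then the minimum degree \<open>3\<close> prevents any force.
\<close>

section \<open>Positive semidefinite forcing in general graphs\<close>

lemma neighbors_sym: "v \<in> neighbors G u \<longleftrightarrow> u \<in> neighbors G v"
  by (simp add: neighbors_def insert_commute)

lemma neighbors_subset_verts:
  assumes "simple_graph G"
  shows "neighbors G u \<subseteq> verts G"
  using assms unfolding simple_graph_def neighbors_def by (fastforce simp: doubleton_eq_iff)

lemma psd_forceD: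
  assumes "psd_force G B u w"
  shows "u \<in> B" "w \<in> verts G" "w \<notin> B" "w \<in> neighbors G u"
proof -
  obtain W where "u \<in> B" and W: "W \<in> component_sets (induced G (verts G - B))" "w \<in> W"
    and N: "neighbors (induced G (W \<union> B)) u - B = {w}"
    using assms unfolding psd_force_def by blast
  then show "u \<in> B" by simp
  show "w \<notin> B" "w \<in> neighbors G u"
    using N by (auto simp: neighbors_def induced_def)
  show "w \<in> verts G"
    using W by (auto simp: component_sets_def quotient_def induced_def)
qed

text \<open>A white path from \<open>w\<close> to \<open>w'\<close> puts \<open>w'\<close> into the
  component in which \<open>u\<close> forces \<open>w\<close>, where \<open>u\<close> sees only one
  white vertex.\<close>

lemma psd_force_unique:
  assumes G: "simple_graph G" and f: "psd_force G B u w"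
    and w': "w' \<in> neighbors G u" "w' \<notin> B"
    and conn: "(w, w') \<in> {(x, y). {x, y} \<in> edges (induced G (verts G - B))}\<^sup>*"
  shows "w' = w"
proof -
  let ?H = "induced G (verts G - B)"
  obtain W where "u \<in> B" and W: "W \<in> component_sets ?H" "w \<in> W"
    and N: "neighbors (induced G (W \<union> B)) u - B = {w}"
    using f unfolding psd_force_def by blast
  from W(1) obtain z where z: "W = {(u, v) \<in> verts ?H \<times> verts ?H.
      (u, v) \<in> {(x, y). {x, y} \<in> edges ?H}\<^sup>*} `` {z}"
    unfolding component_sets_def by (auto elim: quotientE)
  have "w' \<in> verts ?H"
    using neighbors_subset_verts[OF G] w' by (auto simp: induced_def)
  then have "w' \<in> W"
    using W(2) conn unfolding z by (auto intro: rtrancl_trans)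
  then have "w' \<in> neighbors (induced G (W \<union> B)) u - B"
    using w' \<open>u \<in> B\<close> by (auto simp: neighbors_def induced_def)
  then show ?thesis using N by blast
qed

text \<open>The one-edge case, used to block forces: a triangle \<open>u\<close>, \<open>w\<close>,
  \<open>w'\<close> with \<open>w\<close> and \<open>w'\<close> white prevents \<open>u\<close> from
  forcing \<open>w\<close>.\<close>

lemma psd_force_unique_adjacent:
  assumes G: "simple_graph G" and f: "psd_force G B u w"
    and w': "w' \<in> neighbors G u" "w' \<notin> B" "w' \<in> neighbors G w"
  shows False
proof -
  have "w' \<in> verts G" using neighbors_subset_verts[OF G] w' by blast
  then have "{w, w'} \<in> edges (induced G (verts G - B))"
    using psd_forceD[OF f] w' by (auto simp: neighbors_def induced_def)
  then have "w' = w"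
    by (intro psd_force_unique[OF G f w'(1,2)] r_into_rtrancl) simp
  then show False
    using w'(3) G by (auto simp: neighbors_def simple_graph_def doubleton_eq_iff)
qed

lemma component_setsE:
  assumes "w \<in> verts H"
  obtains W where "W \<in> component_sets H" "w \<in> W"
    "\<And>v. v \<in> W \<Longrightarrow> (w, v) \<in> {(x, y). {x, y} \<in> edges H}\<^sup>*"
proof
  let ?R = "{(u, v) \<in> verts H \<times> verts H. (u, v) \<in> {(x, y). {x, y} \<in> edges H}\<^sup>*}"
  show "?R `` {w} \<in> component_sets H"
    unfolding component_sets_def using assms by (rule quotientI)
qed (use assms in auto)

text \<open>Ordinary zero forcing is a special case of the psd rule: restricting to a component can
  only hide white neighbors of \<open>u\<close>.\<close>

lemma psd_force_if_only_white_neighbor: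
  assumes "u \<in> B" "w \<in> verts G" "neighbors G u - B = {w}"
  shows "psd_force G B u w"
proof -
  have "w \<in> verts (induced G (verts G - B))"
    using assms by (auto simp: induced_def)
  then obtain W where "W \<in> component_sets (induced G (verts G - B))" "w \<in> W"
    by (elim component_setsE)
  moreover from this have "neighbors (induced G (W \<union> B)) u - B = {w}"
    using assms by (auto simp: neighbors_def induced_def)
  ultimately show ?thesis
    using assms unfolding psd_force_def by blast
qed

text \<open>Here \<open>{w}\<close> is a whole component, so the other white neighbors of
  \<open>u\<close> lie in other components and do not count.\<close>

lemma psd_force_isolated_white:
  assumes "w \<in> verts G" "w \<notin> B" "neighbors G w \<subseteq> B" "u \<in> neighbors G w"
  shows "psd_force G B u w"
proof -
  let ?H = "induced G (verts G - B)"
  have "w \<in> verts ?H"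
    using assms by (auto simp: induced_def)
  then obtain W where W: "W \<in> component_sets ?H" "w \<in> W"
    "\<And>v. v \<in> W \<Longrightarrow> (w, v) \<in> {(x, y). {x, y} \<in> edges ?H}\<^sup>*"
    by (elim component_setsE) blast
  \<comment> \<open>A nontrivial white path from \<open>w\<close> would begin with an edge to a
    white neighbor of \<open>w\<close>.\<close>
  have "v = w" if "v \<in> W" for v
    using W(3)[OF that]
  proof (cases rule: converse_rtranclE)
    case (step y)
    then show ?thesis
      using assms by (auto simp: neighbors_def induced_def)
  qed simp
  with W(2) have "W = {w}" by blast
  then have "neighbors (induced G (W \<union> B)) u - B = {w}"
    using assms by (auto simp: neighbors_def induced_def insert_commute)
  then show ?thesis
    using W assms unfolding psd_force_def by blast
qed

section \<open>Dependence on the leaks, and general criteria\<close>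

lemma psd_reachable_antimono:
  assumes "psd_reachable G L' B C" "L \<subseteq> L'"
  shows "psd_reachable G L B C"
  using assms by (induction rule: psd_reachable.induct) (auto intro: psd_reachable.intros)

text \<open>For lower bounds: a process that gets anywhere starts with a force valid at
  \<open>B\<close> itself.\<close>

lemma psd_reachable_first_force:
  assumes "psd_reachable G L B C" "C \<noteq> B"
  shows "\<exists>u w. psd_force G B u w"
  using assms by (induction rule: psd_reachable.induct) blast+

text \<open>Any \<open>l\<close> leaks extend to \<open>l'\<close> leaks inside the graph, and
  dropping leaks never hurts.\<close>

lemma leaky_psd_forcing_set_antimono:
  assumes B: "leaky_psd_forcing_set l' G B" and G: "simple_graph G"
    and "l \<le> l'" "l' \<le> card (verts G)"
  shows "leaky_psd_forcing_set l G B"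
  unfolding leaky_psd_forcing_set_def
proof (intro conjI allI impI)
  show "B \<subseteq> verts G" using B by (simp add: leaky_psd_forcing_set_def)
next
  fix L assume L: "L \<subseteq> verts G \<and> card L = l"
  then obtain L' where "L \<subseteq> L'" "L' \<subseteq> verts G" "card L' = l'"
    using exists_subset_between[of L l' "verts G"] assms by (auto simp: simple_graph_def)
  then show "psd_reachable G L B (verts G)"
    using B psd_reachable_antimono[of G L' B "verts G" L] by (simp add: leaky_psd_forcing_set_def)
qed

text \<open>Lets an adversary use fewer than \<open>l\<close> leaks, for instance none.\<close>

lemma leaky_psd_forcing_set_reachable:
  assumes B: "leaky_psd_forcing_set l G B" and G: "simple_graph G"
    and "L \<subseteq> verts G" "card L \<le> l" "l \<le> card (verts G)"
  shows "psd_reachable G L B (verts G)"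
  using leaky_psd_forcing_set_antimono[OF B G, of "card L"] assms
  by (simp add: leaky_psd_forcing_set_def)

lemma leaky_psd_forcing_set_if_independent_complement:
  assumes G: "simple_graph G" and B: "B \<subseteq> verts G"
    and N: "\<And>v. v \<in> verts G - B \<Longrightarrow> neighbors G v \<subseteq> B \<and> l < card (neighbors G v)"
  shows "leaky_psd_forcing_set l G B"
  unfolding leaky_psd_forcing_set_def
proof (intro conjI allI impI B)
  fix L assume L: "L \<subseteq> verts G \<and> card L = l"
  have fin: "finite (verts G)" using G by (simp add: simple_graph_def)
  \<comment> \<open>The white vertices may be forced in any order: the neighbors of each lie in
    \<open>B\<close> from the start, and more than \<open>l\<close> of them cannot all be
    leaks.\<close>
  have "psd_reachable G L B (B \<union> X)" if "finite X" "X \<subseteq> verts G - B" for X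
    using that
  proof (induction X)
    case empty
    then show ?case by (simp add: psd_reachable.start)
  next
    case (insert x X)
    then have reach: "psd_reachable G L B (B \<union> X)" by blast
    have x: "neighbors G x \<subseteq> B" "l < card (neighbors G x)" using N insert.prems by blast+
    have "\<not> neighbors G x \<subseteq> L"
      using x(2) L fin by (meson card_mono finite_subset leD)
    then obtain u where u: "u \<in> neighbors G x" "u \<notin> L" by blast
    have "psd_force G (B \<union> X) u x"
      using insert x u by (intro psd_force_isolated_white) auto
    from psd_reachable.force[OF reach this u(2)] show ?case by simp
  qed
  from this[of "verts G - B"] B fin show "psd_reachable G L B (verts G)"
    by (simp add: Un_absorb1)
qed

text \<open>Make all neighbors of \<open>v\<close> leaks: only a neighbor could ever force
  \<open>v\<close>.\<close>

lemma low_degree_in_leaky_psd_forcing_set: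
  assumes B: "leaky_psd_forcing_set l G B" and G: "simple_graph G"
    and v: "v \<in> verts G" "card (neighbors G v) \<le> l" and l: "l \<le> card (verts G)"
  shows "v \<in> B"
proof (rule ccontr)
  assume "v \<notin> B"
  have "v \<notin> C" if "psd_reachable G (neighbors G v) B C" for C
    using that
  proof (induction rule: psd_reachable.induct)
    case start
    then show ?case using \<open>v \<notin> B\<close> .
  next
    case (force C u w)
    then show ?case using psd_forceD(4)[OF force(2)] neighbors_sym[of w G u] by auto
  qed
  moreover have "psd_reachable G (neighbors G v) B (verts G)"
    using neighbors_subset_verts[OF G] v l by (intro leaky_psd_forcing_set_reachable[OF B G])
  ultimately show False using v by blast
qed

lemma leaky_psd_forcing_number_eqI:
  assumes G: "simple_graph G" and "leaky_psd_forcing_set l G B" "card B = k"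
    and "\<And>B'. leaky_psd_forcing_set l G B' \<Longrightarrow> k \<le> card B'"
  shows "leaky_psd_forcing_number l G = k"
  unfolding leaky_psd_forcing_number_def
proof (rule Min_eqI)
  have "{card B |B. leaky_psd_forcing_set l G B} \<subseteq> card ` Pow (verts G)"
    by (auto simp: leaky_psd_forcing_set_def)
  moreover have "finite (card ` Pow (verts G))" using G by (simp add: simple_graph_def)
  ultimately show "finite {card B |B. leaky_psd_forcing_set l G B}" by (rule finite_subset)
qed (use assms in auto)

section \<open>Forcing in the wheel\<close>

text \<open>Rim vertices are written as \<open>t mod n\<close>, so that arcs may run past \<open>n - 1\<close>.\<close>

lemma Suc_mod_eq_iff: "Suc s mod n = Suc t mod n \<longleftrightarrow> s mod n = t mod n"
  by (auto simp: mod_Suc split: if_splits)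

lemma verts_wheel [simp]: "verts (wheel n) = {0..n}"
  by (simp add: wheel_def)

lemma neighbors_center: "neighbors (wheel n) n = {0..<n}"
  by (auto simp: neighbors_def wheel_def doubleton_eq_iff)

text \<open>Centering the statement at \<open>Suc t\<close> names the predecessor without a
  truncated subtraction.\<close>

lemma neighbors_rim:
  assumes "n \<ge> 3"
  shows "neighbors (wheel n) (Suc t mod n) = {t mod n, Suc (Suc t) mod n, n}"
proof (intro set_eqI)
  fix v
  have lt: "s mod n < n" for s using assms by simp
  have "v \<in> neighbors (wheel n) (Suc t mod n) \<longleftrightarrow>
      (\<exists>i<n. Suc t mod n = i \<and> v = Suc i mod n) \<or>
      (\<exists>i<n. v = i \<and> Suc t mod n = Suc i mod n) \<or> v = n"
    using lt[of "Suc t"]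
    by (auto simp: neighbors_def wheel_def doubleton_eq_iff)
  also have "(\<exists>i<n. Suc t mod n = i \<and> v = Suc i mod n) \<longleftrightarrow> v = Suc (Suc t) mod n"
    using lt[of "Suc t"] by (auto simp: mod_Suc_eq)
  also have "(\<exists>i<n. v = i \<and> Suc t mod n = Suc i mod n) \<longleftrightarrow> v = t mod n"
    using lt[of t] by (auto simp: Suc_mod_eq_iff)
  finally show "v \<in> neighbors (wheel n) (Suc t mod n) \<longleftrightarrow> v \<in> {t mod n, Suc (Suc t) mod n, n}"
    by blast
qed

lemma rim_vertexE:
  assumes "n \<ge> 3" "v < n"
  obtains t where "v = Suc t mod n"
proof
  \<comment> \<open>The summand \<open>n\<close> keeps the subtraction exact at
    \<open>v = 0\<close>.\<close>
  show "v = Suc (v + n - 1) mod n" using assms by simp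
qed

text \<open>The two rim neighbors of a vertex could only coincide if \<open>n\<close> divided
  2.\<close>

lemma neighbors_rim_distinct:
  fixes n :: nat
  assumes "n \<ge> 3"
  shows "t mod n \<noteq> Suc (Suc t) mod n" "t mod n \<noteq> n"
proof -
  have "t mod n < n" using assms by simp
  then show "t mod n \<noteq> n" by linarith
  show "t mod n \<noteq> Suc (Suc t) mod n"
    using assms by (auto simp: mod_Suc split: if_splits)
qed

lemma card_neighbors_rim:
  assumes "n \<ge> 3" "v < n"
  shows "card (neighbors (wheel n) v) = 3"
proof -
  obtain t where "v = Suc t mod n" using rim_vertexE assms by blast
  then show ?thesis
    using neighbors_rim_distinct[OF assms(1)] by (simp add: neighbors_rim[OF assms(1)])
qed

section \<open>At least three blue vertices\<close>

text \<open>A white center is adjacent to every other white vertex. If the center is blue, at most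
  one rim vertex is, and the rest of the rim is still connected.\<close>

lemma wheel_minus_two_connected:
  assumes n: "n \<ge> 3" and B: "card B \<le> 2" "B \<subseteq> {0..n}"
    and w: "w \<in> {0..n} - B" and w': "w' \<in> {0..n} - B"
  shows "(w, w') \<in> {(x, y). {x, y} \<in> edges (induced (wheel n) (verts (wheel n) - B))}\<^sup>*"
    (is "_ \<in> ?E\<^sup>*")
proof -
  have edge: "(x, y) \<in> ?E"
    if "y \<in> neighbors (wheel n) x" "x \<in> {0..n} - B" "y \<in> {0..n} - B" for x y
    using that by (auto simp: induced_def neighbors_def)
  have "sym ?E" by (simp add: sym_def insert_commute)
  then have E_sym: "(y, x) \<in> ?E\<^sup>*" if "(x, y) \<in> ?E\<^sup>*" for x y
    using that by (blast dest: symD[OF sym_rtrancl])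
  \<comment> \<open>By symmetry of \<open>?E\<close> one vertex reaching all white vertices is
    enough.\<close>
  have "\<exists>c. \<forall>v \<in> {0..n} - B. (c, v) \<in> ?E\<^sup>*"
  proof (cases "n \<in> B")
    case False
    have "(n, v) \<in> ?E\<^sup>*" if "v \<in> {0..n} - B" for v
      using edge[of v n] that False
      by (cases "v = n") (auto simp: neighbors_center)
    then show ?thesis by blast
  next
    case True
    have "card (B - {n}) \<le> Suc 0" using B True by simp
    moreover have "finite (B - {n})" using B finite_subset by auto
    ultimately have one: "x = y" if "x \<in> B - {n}" "y \<in> B - {n}" for x y
      using that by (auto simp: card_le_Suc0_iff_eq)
    \<comment> \<open>\<open>a\<close> is the blue rim vertex, or arbitrarily 0 if the rim is
      white.\<close>
    obtain a where a: "a < n" "B \<subseteq> {a, n}"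
    proof (cases "B - {n} = {}")
      case True
      then show ?thesis using that[of 0] n by auto
    next
      case False
      then obtain a where "a \<in> B - {n}" by blast
      then have "a < n" "B - {n} \<subseteq> {a}" using B one by (fastforce, blast)
      then show ?thesis using that[of a] by blast
    qed
    have mod_a: "t mod n \<noteq> a" if "a < t" "t < a + n" for t
    proof
      assume "t mod n = a"
      then have "t mod n = a mod n" using a by simp
      then have "n dvd t - a" using that by (simp add: mod_eq_dvd_iff_nat)
      then show False using that by (auto dest: dvd_imp_le)
    qed
    \<comment> \<open>A walk once around the rim, starting just after \<open>a\<close>. The end
      \<open>a + n\<close> is included because \<open>a\<close> itself may be white.\<close>
    have arc: "(Suc a mod n, t mod n) \<in> ?E\<^sup>*" if "Suc a \<le> t" "t \<le> a + n" "t mod n \<notin> B" for t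
      using that
    proof (induction t rule: dec_induct)
      case base
      then show ?case by simp
    next
      case (step t)
      have "t mod n \<notin> B"
      proof -
        have "t mod n < n" using n by simp
        then have "t mod n \<noteq> n" by linarith
        then show ?thesis using a mod_a[of t] step by auto
      qed
      moreover from this have "(t mod n, Suc t mod n) \<in> ?E"
        using step n neighbors_rim[OF n, of t] neighbors_sym[of "Suc t mod n"]
        by (intro edge) (auto simp: less_imp_le)
      ultimately show ?case
        using step by (meson Suc_leD rtrancl.rtrancl_into_rtrancl)
    qed
    \<comment> \<open>The walk meets \<open>v\<close> at position \<open>v\<close> if
      \<open>a < v\<close>, and otherwise at \<open>v + n\<close>.\<close>
    have "(Suc a mod n, v) \<in> ?E\<^sup>*" if "v \<in> {0..n} - B" for v
    proof -
      have "v < n" using that True by (cases "v = n") auto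
      then show ?thesis
        using arc[of v] arc[of "v + n"] that a(1) by (cases "a < v") auto
    qed
    then show ?thesis by blast
  qed
  then show ?thesis using w w' E_sym by (meson rtrancl_trans)
qed

text \<open>With two blue vertices even the leak-free process cannot start: the white part is
  connected, so a forcing \<open>u\<close> would have only \<open>w\<close> and the other blue
  vertex as possible neighbors, against minimum degree 3.\<close>

lemma wheel_leaky_psd_forcing_set_card_ge_3:
  assumes n: "n \<ge> 3" and B: "leaky_psd_forcing_set l (wheel n) B" and l: "l \<le> n + 1"
  shows "3 \<le> card B"
proof (rule ccontr)
  assume "\<not> 3 \<le> card B"
  then have card: "card B \<le> 2" by simp
  have BV: "B \<subseteq> {0..n}" using B by (simp add: leaky_psd_forcing_set_def)
  then have finB: "finite B" using finite_subset by blast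
  have "psd_reachable (wheel n) {} B {0..n}"
    using leaky_psd_forcing_set_reachable[OF B simple_graph_wheel[OF n], of "{}"] l by simp
  moreover have "{0..n} \<noteq> B"
    using card n by auto
  ultimately obtain u w where f: "psd_force (wheel n) B u w"
    using psd_reachable_first_force by blast
  note fD = psd_forceD[OF f]
  have "neighbors (wheel n) u \<subseteq> insert w (B - {u})"
  proof
    fix x assume x: "x \<in> neighbors (wheel n) u"
    then have xV: "x \<in> {0..n}" "x \<noteq> u"
      using neighbors_subset_verts[OF simple_graph_wheel[OF n]] simple_graph_wheel[OF n]
      by (auto simp: neighbors_def simple_graph_def doubleton_eq_iff)
    show "x \<in> insert w (B - {u})"
    proof (cases "x \<in> B")
      case False
      then have "x = w"
        using wheel_minus_two_connected[OF n card BV, of w x] xV fD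
        by (intro psd_force_unique[OF simple_graph_wheel[OF n] f x]) auto
      then show ?thesis by simp
    qed (use xV in simp)
  qed
  then have "card (neighbors (wheel n) u) \<le> card (insert w (B - {u}))"
    using finB by (intro card_mono) auto
  also have "\<dots> \<le> 2"
    using card finB fD by (simp add: card_insert_if)
  finally have "card (neighbors (wheel n) u) \<le> 2" .
  moreover have "u < n \<or> u = n" using fD BV by force
  ultimately show False
    using card_neighbors_rim[OF n, of u] n by (auto simp: neighbors_center)
qed

section \<open>The upper bound for one leak\<close>

lemma wheel_1_leaky_psd_forcing_set:
  assumes n: "n \<ge> 3"
  shows "leaky_psd_forcing_set 1 (wheel n) {0, 1, n}"
  unfolding leaky_psd_forcing_set_def
proof (intro conjI allI impI)
  show "{0, 1, n} \<subseteq> verts (wheel n)" using n by simp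
next
  fix L assume "L \<subseteq> verts (wheel n) \<and> card L = 1"
  then obtain v where L: "L = {v}" by (auto simp: card_1_singleton_iff)
  \<comment> \<open>The white arc runs from \<open>i + 1\<close> to \<open>j - 1\<close>. Its right
    end is \<open>j mod n\<close>: initially \<open>j = n\<close>, where the end is rim vertex 0 and
    \<open>{n}\<close> is the center.\<close>
  let ?C = "\<lambda>i j. {0..i} \<union> {j..n}"
  have start: "?C 1 n = {0, 1, n}" by auto
  have main: "psd_reachable (wheel n) L {0, 1, n} {0..n}"
    if "psd_reachable (wheel n) L {0, 1, n} (?C i j)" "1 \<le> i" "i < j" "j \<le> n" for i j
    using that
  proof (induction "j - i" arbitrary: i j rule: less_induct)
    case less
    show ?case
    proof (cases "j = Suc i")
      case True
      then have "?C i j = {0..n}" using less by auto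
      then show ?thesis using less by simp
    next
      case False
      then have ij: "Suc i < j" using less by simp
      show ?thesis
      proof (cases "i \<in> L")
        case False
        obtain k where k: "i = Suc k" using less by (cases i) auto
        have "neighbors (wheel n) i = {k, Suc i, n}"
          using neighbors_rim[OF n, of k] k ij less by simp
        then have "psd_force (wheel n) (?C i j) i (Suc i)"
          using ij less k by (intro psd_force_if_only_white_neighbor) auto
        from psd_reachable.force[OF less.prems(1) this False]
        have "psd_reachable (wheel n) L {0, 1, n} (?C (Suc i) j)"
          by (simp add: atLeast0_atMost_Suc)
        then show ?thesis using less.hyps[of j "Suc i"] ij less by simp
      next
        case True
        obtain k where k: "j = Suc k" using ij by (cases j) auto
        \<comment> \<open>The leak is \<open>i\<close>, and the other end differs from it: it is 0
          if \<open>j = n\<close>, and larger than \<open>i\<close> otherwise.\<close>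
        have "j mod n \<notin> L"
          using True L ij less by (cases "j = n") auto
        have "neighbors (wheel n) (j mod n) = {k, Suc j mod n, n}"
          using neighbors_rim[OF n, of k] k less by simp
        moreover have "Suc j mod n \<in> ?C i j" "j mod n \<in> ?C i j"
          using ij less n by (auto simp: mod_Suc le_less)
        ultimately have "psd_force (wheel n) (?C i j) (j mod n) k"
          using ij less k by (intro psd_force_if_only_white_neighbor) auto
        from psd_reachable.force[OF less.prems(1) this \<open>j mod n \<notin> L\<close>]
        have "psd_reachable (wheel n) L {0, 1, n} (insert k (?C i j))" .
        also have "insert k (?C i j) = ?C i k" using k ij less by auto
        finally show ?thesis using less.hyps[of k i] ij less k by simp
      qed
    qed
  qed
  show "psd_reachable (wheel n) L {0, 1, n} (verts (wheel n))"
    using main[of 1 n] n psd_reachable.start[of "wheel n" L "{0, 1, n}"] start by simp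
qed

section \<open>Two leaks\<close>

lemma wheel_2_leaky_psd_forcing_set:
  assumes n: "n \<ge> 3"
  shows "leaky_psd_forcing_set 2 (wheel n) (insert n {i. i < n \<and> even i})"
    (is "leaky_psd_forcing_set _ _ ?B")
proof (rule leaky_psd_forcing_set_if_independent_complement[OF simple_graph_wheel[OF n]])
  show "?B \<subseteq> verts (wheel n)" by auto
next
  fix v assume v: "v \<in> verts (wheel n) - ?B"
  then have "v < n" "odd v" by auto
  then obtain k where k: "v = Suc k" "even k" by (auto elim: oddE)
  have "neighbors (wheel n) v = {k, Suc (Suc k) mod n, n}"
    using neighbors_rim[OF n, of k] \<open>v < n\<close> k by simp
  moreover have "Suc (Suc k) mod n \<in> ?B"
    \<comment> \<open>If the last rim vertex is odd, its successor wraps around to 0, which is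
      even.\<close>
    using \<open>v < n\<close> k by (cases "Suc (Suc k) = n") auto
  ultimately show "neighbors (wheel n) v \<subseteq> ?B \<and> 2 < card (neighbors (wheel n) v)"
    using card_neighbors_rim[OF n \<open>v < n\<close>] \<open>v < n\<close> k by auto
qed

lemma card_even_less: "card {i. i < n \<and> even i} = (n + 1) div 2"
proof (induction n)
  case (Suc n)
  have "{i. i < Suc n \<and> even i} = (if even n then insert n else id) {i. i < n \<and> even i}"
    by (auto simp: less_Suc_eq)
  then show ?case using Suc by auto
qed simp

text \<open>From outside the arc, only its two ends and the center can force into it. The ends are
  leaks, and the center sees two adjacent white vertices.\<close>

lemma white_arc_blocked:
  assumes n: "n \<ge> 3" and L: "{s mod n, e mod n} \<subseteq> L" and long: "Suc (Suc s) < e"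
    and B: "B \<inter> (\<lambda>t. t mod n) ` {s<..<e} = {}"
    and reach: "psd_reachable (wheel n) L B C"
  shows "C \<inter> (\<lambda>t. t mod n) ` {s<..<e} = {}"
  using reach
proof (induction rule: psd_reachable.induct)
  case start
  then show ?case using B .
next
  case (force C u w)
  let ?S = "(\<lambda>t. t mod n) ` {s<..<e}"
  have "w \<notin> ?S"
  proof
    assume "w \<in> ?S"
    then obtain t where t: "w = t mod n" "s < t" "t < e" by auto
    then obtain k where k: "t = Suc k" by (cases t) auto
    have "u \<in> neighbors (wheel n) w"
      using psd_forceD(4)[OF force(2)] by (simp add: neighbors_sym[of u])
    then have "u \<in> {k mod n, Suc t mod n, n}"
      using neighbors_rim[OF n, of k] t k by simp
    moreover have "k mod n \<in> ?S \<or> k = s" "Suc t mod n \<in> ?S \<or> Suc t = e"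
      using t k by auto
    moreover have "u \<notin> ?S" using psd_forceD(1)[OF force(2)] force by blast
    ultimately have u: "u = n" using L force by auto
    \<comment> \<open>By \<open>long\<close> the arc has at least two positions: the first one has a
      successor in it, any other a predecessor.\<close>
    have "\<exists>w'. w' \<in> ?S \<and> w' \<in> neighbors (wheel n) w"
    proof (cases "k = s")
      case True
      then show ?thesis
        using neighbors_rim[OF n, of k] t k long by (intro exI[of _ "Suc t mod n"]) auto
    next
      case False
      then show ?thesis
        using neighbors_rim[OF n, of k] t k by (intro exI[of _ "k mod n"]) auto
    qed
    then obtain w' where w': "w' \<in> ?S" "w' \<in> neighbors (wheel n) w" by blast
    have "w' \<in> neighbors (wheel n) u" "w' \<notin> C"
      using w' force n u by (auto simp: neighbors_center)
    then show False
      by (rule psd_force_unique_adjacent[OF simple_graph_wheel[OF n] force(2) _ _ w'(2)])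
  qed
  then show ?case using force by blast
qed

text \<open>Otherwise put the leaks on the blue ends of the maximal white arc through the two white
  vertices.\<close>

lemma wheel_2_leaky_no_adjacent_white_rim:
  assumes n: "n \<ge> 3" and B: "leaky_psd_forcing_set 2 (wheel n) B" and x: "x < n" "x \<notin> B"
  shows "Suc x mod n \<in> B"
proof (rule ccontr)
  assume x': "Suc x mod n \<notin> B"
  \<comment> \<open>The arc has ends only if some rim vertex is blue.\<close>
  have "B \<inter> {0..<n} \<noteq> {}"
  proof
    assume "B \<inter> {0..<n} = {}"
    then have "B \<subseteq> {n}" using B by (force simp: leaky_psd_forcing_set_def)
    then have "card B \<le> card {n}" by (intro card_mono) auto
    then show False
      using wheel_leaky_psd_forcing_set_card_ge_3[OF n B] n by simp
  qed
  then obtain a where a: "a < n" "a \<in> B" by auto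
  let ?P = "\<lambda>t. t mod n \<in> B"
  \<comment> \<open>Position \<open>x + n\<close> stands for \<open>x\<close> and leaves room to the
    left: a blue vertex \<open>a\<close> occurs at or before it as \<open>a\<close>, and after it as
    \<open>a + 2 * n\<close>.\<close>
  define s where "s = (GREATEST t. ?P t \<and> t \<le> x + n)"
  define e where "e = (LEAST t. ?P t \<and> x + n \<le> t)"
  have "?P a \<and> a \<le> x + n" using a by simp
  then have s: "?P s \<and> s \<le> x + n" and s_max: "\<And>t. ?P t \<and> t \<le> x + n \<Longrightarrow> t \<le> s"
    unfolding s_def
    by (rule GreatestI_nat[where b = "x + n"], simp) (rule Greatest_le_nat[where b = "x + n"], auto)
  have "?P (a + 2 * n) \<and> x + n \<le> a + 2 * n" using a x by simp
  then have e: "?P e \<and> x + n \<le> e" and e_min: "\<And>t. ?P t \<and> x + n \<le> t \<Longrightarrow> e \<le> t"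
    unfolding e_def by (rule LeastI) (rule Least_le)
  have white: "\<not> ?P (x + n)" "\<not> ?P (Suc (x + n))"
    using x x' by (auto simp: mod_Suc)
  then have "s \<noteq> x + n" "e \<noteq> x + n" "e \<noteq> Suc (x + n)" using s e by metis+
  then have long: "Suc (Suc s) < e" using s e by linarith
  have gap: "B \<inter> (\<lambda>t. t mod n) ` {s<..<e} = {}"
  proof -
    have "\<not> ?P t" if "s < t" "t < e" for t
      using s_max[of t] e_min[of t] that by (cases "t \<le> x + n") auto
    then show ?thesis by auto
  qed
  \<comment> \<open>Both ends are the same vertex when the rim has a single blue vertex.\<close>
  have "card {s mod n, e mod n} \<le> 2" by (simp add: card_insert_if)
  then have "psd_reachable (wheel n) {s mod n, e mod n} B (verts (wheel n))"
    using n by (intro leaky_psd_forcing_set_reachable[OF B simple_graph_wheel[OF n]])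
      (auto simp: less_imp_le)
  from white_arc_blocked[OF n order.refl long gap this]
  have "{0..n} \<inter> (\<lambda>t. t mod n) ` {s<..<e} = {}" by simp
  moreover have "Suc s mod n \<in> (\<lambda>t. t mod n) ` {s<..<e}" using long by simp
  moreover have "Suc s mod n \<in> {0..n}" using n by (simp add: less_imp_le)
  ultimately show False by blast
qed

text \<open>Rim succession maps white vertices injectively to blue ones, so at least half the rim is
  blue; a blue center adds one. If the center is white, the first force creates three consecutive
  blue rim vertices as a prerequisite, which costs as much.\<close>

lemma wheel_2_leaky_psd_forcing_set_card_ge:
  assumes n: "n \<ge> 3" and B: "leaky_psd_forcing_set 2 (wheel n) B"
  shows "(n + 1) div 2 + 1 \<le> card B"
proof -
  let ?R = "B \<inter> {0..<n}" and ?W = "{0..<n} - B"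
  have BV: "B \<subseteq> {0..n}" using B by (simp add: leaky_psd_forcing_set_def)
  then have finB: "finite B" using finite_subset by blast
  have inj: "inj_on (\<lambda>x. Suc x mod n) ?W"
    by (auto simp: inj_on_def Suc_mod_eq_iff)
  have sub: "(\<lambda>x. Suc x mod n) ` ?W \<subseteq> ?R"
    using wheel_2_leaky_no_adjacent_white_rim[OF n B] n by auto
  have total: "card ?W + card ?R = n"
    using card_Int_Diff[of "{0..<n}" B] by (simp add: Int_commute)
  show ?thesis
  proof (cases "n \<in> B")
    case True
    have "card ?W \<le> card ?R"
      using card_inj_on_le[OF inj sub] by simp
    moreover have "B = insert n ?R" using True BV by force
    then have "card B = Suc (card ?R)" using card_insert_disjoint[of ?R n] by simp
    ultimately show ?thesis using total by linarith
  next
    case False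
    have "psd_reachable (wheel n) {} B {0..n}"
      using leaky_psd_forcing_set_reachable[OF B simple_graph_wheel[OF n], of "{}"] n by simp
    moreover have "{0..n} \<noteq> B" using False by auto
    ultimately obtain u w where f: "psd_force (wheel n) B u w"
      using psd_reachable_first_force by blast
    note fD = psd_forceD[OF f]
    have "u < n" using fD BV False by (metis atLeastAtMost_iff le_neq_implies_less subsetD)
    then obtain t where t: "u = Suc t mod n" using rim_vertexE[OF n] by blast
    text \<open>The white center is adjacent to every white vertex, so it is the vertex forced by \<open>u\<close>.\<close>
    have nu: "n \<in> neighbors (wheel n) u" by (simp add: t neighbors_rim[OF n])
    have w: "w = n"
    proof (rule ccontr)
      assume "w \<noteq> n"
      then have "n \<in> neighbors (wheel n) w"
        using fD neighbors_sym[of n _ w] by (auto simp: neighbors_center)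
      then show False
        using psd_force_unique_adjacent[OF simple_graph_wheel[OF n] f nu False] by blast
    qed
    \<comment> \<open>A white rim neighbor of \<open>u\<close> would be adjacent to the forced
      center.\<close>
    have blue: "x \<in> B" if "x \<in> neighbors (wheel n) u" "x < n" for x
      using psd_force_unique_adjacent[OF simple_graph_wheel[OF n] f that(1)] that w
      by (auto simp: neighbors_center)
    have t_blue: "t mod n \<in> B" and st_blue: "Suc (Suc t) mod n \<in> B"
      using blue n by (auto simp: t neighbors_rim)
    \<comment> \<open>\<open>Suc t\<close> and \<open>Suc (Suc t)\<close> follow the blue vertices
      \<open>t\<close> and \<open>Suc t\<close>, so the succession map misses both.\<close>
    have "(\<lambda>x. Suc x mod n) ` ?W \<subseteq> ?R - {Suc t mod n, Suc (Suc t) mod n}"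
      using sub t_blue fD(1) t by (auto simp: Suc_mod_eq_iff)
    then have "card ?W \<le> card (?R - {Suc t mod n, Suc (Suc t) mod n})"
      using inj finB by (intro card_inj_on_le) auto
    also have "\<dots> = card ?R - 2"
    proof -
      have "Suc t mod n \<noteq> Suc (Suc t) mod n"
        using n by (auto simp: mod_Suc split: if_splits)
      then show ?thesis
        using n fD(1) t st_blue by (subst card_Diff_subset) auto
    qed
    finally have "card ?W \<le> card ?R - 2" .
    moreover have "B = ?R" using False BV by (auto simp: le_less)
    then have "card B = card ?R" by simp
    \<comment> \<open>This makes the truncated subtraction \<open>card ?R - 2\<close> exact.\<close>
    moreover have "3 \<le> card B"
      using wheel_leaky_psd_forcing_set_card_ge_3[OF n B] n by simp
    ultimately show ?thesis using total by linarith
  qed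
qed

section \<open>The four cases of the formula\<close>

theorem theorem23:
  fixes n l :: nat
  assumes "n \<ge> 3"
  shows "(l \<in> {0, 1} \<longrightarrow> leaky_psd_forcing_number l (wheel n) = 3) \<and>
         (l = 2 \<longrightarrow> leaky_psd_forcing_number l (wheel n) = nat \<lceil>real n / 2\<rceil> + 1) \<and>
         (2 < l \<and> l < n \<longrightarrow> leaky_psd_forcing_number l (wheel n) = n) \<and>
         (l \<in> {n, n + 1} \<longrightarrow> leaky_psd_forcing_number l (wheel n) = n + 1)"
proof -
  note G = simple_graph_wheel[OF assms]
  \<comment> \<open>Three leaks can surround any rim vertex.\<close>
  have low: "v \<in> B"
    if "leaky_psd_forcing_set l (wheel n) B" "3 \<le> l" "l \<le> n + 1" "v < n" for B v
    using that low_degree_in_leaky_psd_forcing_set[OF that(1) G, of v]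
      card_neighbors_rim[OF assms that(4)] by simp
  show ?thesis
  proof (intro conjI impI)
    assume l: "l \<in> {0, 1}"
    show "leaky_psd_forcing_number l (wheel n) = 3"
    proof (rule leaky_psd_forcing_number_eqI[OF G])
      show "leaky_psd_forcing_set l (wheel n) {0, 1, n}"
        using l assms
        by (intro leaky_psd_forcing_set_antimono[OF wheel_1_leaky_psd_forcing_set G]) auto
      show "card {0, 1, n} = 3" using assms by simp
      show "3 \<le> card B" if "leaky_psd_forcing_set l (wheel n) B" for B
        using wheel_leaky_psd_forcing_set_card_ge_3[OF assms that] l by auto
    qed
  next
    assume l: "l = 2"
    have "nat \<lceil>real n / 2\<rceil> = (n + 1) div 2" by linarith
    moreover have "leaky_psd_forcing_number l (wheel n) = (n + 1) div 2 + 1"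
      unfolding l
      by (rule leaky_psd_forcing_number_eqI[OF G wheel_2_leaky_psd_forcing_set[OF assms]])
        (simp_all add: card_even_less[simplified]
          wheel_2_leaky_psd_forcing_set_card_ge[OF assms, simplified])
    ultimately show "leaky_psd_forcing_number l (wheel n) = nat \<lceil>real n / 2\<rceil> + 1" by simp
  next
    assume l: "2 < l \<and> l < n"
    show "leaky_psd_forcing_number l (wheel n) = n"
    proof (rule leaky_psd_forcing_number_eqI[OF G])
      show "leaky_psd_forcing_set l (wheel n) {0..<n}"
      proof (rule leaky_psd_forcing_set_if_independent_complement[OF G])
        fix v assume "v \<in> verts (wheel n) - {0..<n}"
        then have "v = n" by auto
        then show "neighbors (wheel n) v \<subseteq> {0..<n} \<and> l < card (neighbors (wheel n) v)"
          using l by (simp add: neighbors_center)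
      qed auto
      fix B assume B: "leaky_psd_forcing_set l (wheel n) B"
      then have "{0..<n} \<subseteq> B" using low l by auto
      moreover have "finite B"
        using B by (auto simp: leaky_psd_forcing_set_def intro: finite_subset)
      ultimately show "n \<le> card B" using card_mono[of B "{0..<n}"] by simp
    qed simp
  next
    assume l: "l \<in> {n, n + 1}"
    show "leaky_psd_forcing_number l (wheel n) = n + 1"
    proof (rule leaky_psd_forcing_number_eqI[OF G])
      show "leaky_psd_forcing_set l (wheel n) {0..n}"
        by (rule leaky_psd_forcing_set_if_independent_complement[OF G]) auto
      fix B assume B: "leaky_psd_forcing_set l (wheel n) B"
      \<comment> \<open>With \<open>n\<close> leaks the center can be surrounded as well.\<close>
      have "n \<in> B"
        using l by (intro low_degree_in_leaky_psd_forcing_set[OF B G]) (auto simp: neighbors_center)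
      moreover have "{0..<n} \<subseteq> B" using low[OF B] l assms by auto
      moreover have "{0..n} = insert n {0..<n}" by auto
      ultimately have "{0..n} \<subseteq> B" by simp
      moreover have "finite B"
        using B by (auto simp: leaky_psd_forcing_set_def intro: finite_subset)
      ultimately show "n + 1 \<le> card B" using card_mono[of B "{0..n}"] by simp
    qed simp
  qed
qed

end
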